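(* For every $n\ge 3$, we have $\operatorname{cr}(K_n)=3n$, where $K_n$ is the complete graph on $n$ vertices.
   Context: All graphs are finite, simple, undirected and labelled. A bicoloration (bicoloring) of a graph $G$ is a map $\beta:V(G)\to\{-1,1\}$, and a bicolored graph is a pair $B=(G,\beta)$. The local complement $G*a$ of $G$ at a vertex $a$ is obtained from $G$ by complementing the subgraph induced by the open neighborhood $N_G(a)$ and leaving all other adjacencies unchanged. The local inversion of $B=(G,\beta)$ at $a\in V(G)$ is $B_a=(G*a,\beta_a)$, where $\beta_a(x)=-\beta(x)$ if $x\in N_G(a)$ and $\beta_a(x)=\beta(x)$ otherwise. A string is a finite (possibly empty) sequence of vertices of $G$ (repetitions allowed); for a string $w=x_1\cdots x_k$ its length is $|w|=k$, and $B_w$ is the bicolored graph obtained from $B$ by applying the local inversions at $x_1,\ldots,x_k$ in this order, each neighborhood being taken in the current underlying graph. The color-reversal number $\operatorname{cr}(G)$ is the minimum length of a string $w$ of vertices of $G$ such that, for every bicoloring $\beta$ of $G$, $(G,\beta)_w=(G,-\beta)$, i.e. applying the local inversions in $w$ returns the underlying graph to $G$ and changes every color. (The effect of a fixed string on which colors are changed is independent of the initial coloring, so it is equivalent to require this for one bicoloring.) *)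

theory Defs
  imports Main "HOL-Library.FuncSet" "HOL-Library.Extended_Nat" "HOL-Library.Ramsey"
begin

record 'a graph =
  verts :: "'a set"
  edges :: "'a set set"

definition simple_graph :: "'a graph \<Rightarrow> bool" where
  "simple_graph G \<longleftrightarrow> finite (verts G) \<and> edges G \<subseteq> nsets (verts G) 2"

definition complete_graph :: "'a set \<Rightarrow> 'a graph" where
  "complete_graph V = \<lparr>verts = V, edges = nsets V 2\<rparr>"

definition neighborhood :: "'a graph \<Rightarrow> 'a \<Rightarrow> 'a set" where
  "neighborhood G a = {x \<in> verts G. {a, x} \<in> edges G}"

definition local_complement :: "'a graph \<Rightarrow> 'a \<Rightarrow> 'a graph" where
  "local_complement G a =
     (let P = nsets (neighborhood G a) 2
      in \<lparr>verts = verts G, edges = (edges G - P) \<union> (P - edges G)\<rparr>)"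

text \<open>Colorings are extensional (\<^term>\<open>undefined\<close> outside the vertex set), so that equality
  of bicolored graphs is plain equality of pairs.\<close>

type_synonym 'a bicolored_graph = "'a graph \<times> ('a \<Rightarrow> int)"

definition bicolorings :: "'a graph \<Rightarrow> ('a \<Rightarrow> int) set" where
  "bicolorings G = verts G \<rightarrow>\<^sub>E {-1, 1}"

definition local_inversion :: "'a bicolored_graph \<Rightarrow> 'a \<Rightarrow> 'a bicolored_graph" where
  "local_inversion B a =
     (local_complement (fst B) a,
      \<lambda>x. if x \<in> neighborhood (fst B) a then - snd B x else snd B x)"

definition apply_string :: "'a bicolored_graph \<Rightarrow> 'a list \<Rightarrow> 'a bicolored_graph" where
  "apply_string B w = foldl local_inversion B w"

definition color_reversing :: "'a graph \<Rightarrow> 'a list \<Rightarrow> bool" where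
  "color_reversing G w \<longleftrightarrow>
     set w \<subseteq> verts G \<and>
     (\<forall>\<beta> \<in> bicolorings G. apply_string (G, \<beta>) w = (G, restrict (\<lambda>x. - \<beta> x) (verts G)))"

text \<open>The infimum in \<^typ>\<open>enat\<close> is a minimum when a color-reversing string exists and
  \<open>\<infinity>\<close> otherwise (for example, if the graph has an isolated vertex).\<close>

definition cr :: "'a graph \<Rightarrow> enat" where
  "cr G = (INF w \<in> {w. color_reversing G w}. enat (length w))"

lemma simple_graph_complete_graph: "finite V \<Longrightarrow> simple_graph (complete_graph V)"
  by (simp add: simple_graph_def complete_graph_def)

lemma simple_graph_local_complement:
  assumes "simple_graph G"
  shows "simple_graph (local_complement G a)"
proof -
  have "nsets (neighborhood G a) 2 \<subseteq> nsets (verts G) 2"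
    by (rule nsets_mono) (auto simp: neighborhood_def)
  then show ?thesis
    using assms by (auto simp: simple_graph_def local_complement_def Let_def)
qed

lemma bicolorings_local_inversion:
  assumes "\<beta> \<in> bicolorings G"
  shows "snd (local_inversion (G, \<beta>) a) \<in> bicolorings (local_complement G a)"
  using assms
  by (auto simp: bicolorings_def local_inversion_def local_complement_def Let_def
      neighborhood_def PiE_iff extensional_def)

end

theory Submission imports Defs begin

text \<open>
  Call a local inversion at \<open>a\<close> a press of \<open>a\<close>. Pressing \<open>a\<close> in \<open>K\<^sub>n\<close> gives the star centred at \<open>a\<close>
  and flips the colours of all other vertices. Pressing a leaf of a star leaves the graph alone
  and flips the colour of the centre only, and pressing the centre gives \<open>K\<^sub>n\<close> again. So a string that starts and ends at \<open>K\<^sub>n\<close> is a succession of blocks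
  \<open>a, leaf, \<dots>, leaf, a\<close>. The first and the last press of a block both flip everything except
  \<open>a\<close> and cancel each other, so the block flips \<open>a\<close> if its number of leaf presses is odd, and
  otherwise does nothing. A block that flips its centre therefore has length at least \<open>3\<close>, and
  each of the \<open>n\<close> vertices needs one: this gives the lower bound, and \<open>n\<close> blocks
  \<open>a, leaf, a\<close>, one for each vertex, attain it. The assumption \<open>n \<ge> 3\<close> makes the star different
  from \<open>K\<^sub>n\<close>, so that the string cannot stop inside a block.

  Formally, the current graph is accompanied by the set \<open>D\<close> of vertices whose colour would be
  reversed if an open block were closed at once (see \<open>clique_state\<close> and \<open>star_state\<close>). Opening or
  closing a block leaves \<open>D\<close> unchanged, and a leaf press toggles membership of the centre. The
  lower bound is then an invariant between \<open>card D\<close> and the length of the string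
  (\<open>string_invariant\<close>).
\<close>

definition star_graph :: "'a set \<Rightarrow> 'a \<Rightarrow> 'a graph" where
  "star_graph V c = \<lparr>verts = V, edges = (\<lambda>x. {c, x}) ` (V - {c})\<rparr>"

definition flip :: "'a set \<Rightarrow> ('a \<Rightarrow> int) \<Rightarrow> 'a \<Rightarrow> int" where
  "flip F \<beta> = (\<lambda>x. if x \<in> F then - \<beta> x else \<beta> x)"

definition clique_state :: "'a set \<Rightarrow> ('a \<Rightarrow> int) \<Rightarrow> 'a set \<Rightarrow> 'a bicolored_graph" where
  "clique_state V \<beta> D = (complete_graph V, flip D \<beta>)"

text \<open>
  The press that opened the block has flipped all leaves, and the press that closes it will do so
  again. Taking the symmetric difference with the leaves discounts this, so that \<open>D\<close> has the
  same meaning as in \<open>clique_state\<close>.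
\<close>

definition star_state :: "'a set \<Rightarrow> ('a \<Rightarrow> int) \<Rightarrow> 'a set \<Rightarrow> 'a \<Rightarrow> 'a bicolored_graph" where
  "star_state V \<beta> D c = (star_graph V c, flip (sym_diff D (V - {c})) \<beta>)"

lemma local_inversion_flip:
  "local_inversion (G, flip F \<beta>) a =
     (local_complement G a, flip (sym_diff F (neighborhood G a)) \<beta>)"
  by (auto simp: local_inversion_def flip_def fun_eq_iff)

lemma neighborhood_complete_graph:
  assumes "a \<in> V"
  shows "neighborhood (complete_graph V) a = V - {a}"
  using assms by (auto simp: neighborhood_def complete_graph_def nsets_def card_2_iff doubleton_eq_iff)

lemma neighborhood_star_graph:
  assumes "c \<in> V" "a \<in> V"
  shows "neighborhood (star_graph V c) a = (if a = c then V - {c} else {c})"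
  using assms by (auto simp: neighborhood_def star_graph_def doubleton_eq_iff)

lemma nsets_2_split_at_vertex:
  assumes "c \<in> V"
  shows "nsets V 2 = (\<lambda>x. {c, x}) ` (V - {c}) \<union> nsets (V - {c}) 2"
  using assms by (auto simp: nsets_def card_2_iff image_iff)

lemma star_edges_disjoint: "(\<lambda>x. {c, x}) ` (V - {c}) \<inter> nsets (V - {c}) 2 = {}"
  by (auto simp: nsets_def)

lemma local_complement_complete_graph:
  assumes "c \<in> V"
  shows "local_complement (complete_graph V) c = star_graph V c"
  using nsets_2_split_at_vertex[OF assms] star_edges_disjoint[of c V]
  by (auto simp: local_complement_def Let_def neighborhood_complete_graph[OF assms])
     (auto simp: complete_graph_def star_graph_def)

lemma local_complement_star_graph_centre:
  assumes "c \<in> V"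
  shows "local_complement (star_graph V c) c = complete_graph V"
  using nsets_2_split_at_vertex[OF assms] star_edges_disjoint[of c V]
  by (auto simp: local_complement_def Let_def neighborhood_star_graph[OF assms assms])
     (auto simp: complete_graph_def star_graph_def)

lemma local_complement_star_graph_leaf:
  assumes "c \<in> V" "a \<in> V" "a \<noteq> c"
  shows "local_complement (star_graph V c) a = star_graph V c"
proof -
  have "nsets {c} 2 = {}"
    by (auto simp: nsets_def card_2_iff)
  then show ?thesis
    using assms by (simp add: local_complement_def neighborhood_star_graph)
qed

lemma open_block:
  assumes "a \<in> V"
  shows "local_inversion (clique_state V \<beta> D) a = star_state V \<beta> D a"
  using assms
  by (simp add: clique_state_def star_state_def local_inversion_flip
      neighborhood_complete_graph local_complement_complete_graph)

lemma close_block: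
  assumes "c \<in> V"
  shows "local_inversion (star_state V \<beta> D c) c = clique_state V \<beta> D"
proof -
  have "sym_diff (sym_diff D (V - {c})) (V - {c}) = D"
    by auto
  then show ?thesis
    using assms
    by (simp add: clique_state_def star_state_def local_inversion_flip
        neighborhood_star_graph local_complement_star_graph_centre)
qed

lemma press_leaf:
  assumes "c \<in> V" "a \<in> V" "a \<noteq> c"
  shows "local_inversion (star_state V \<beta> D c) a = star_state V \<beta> (sym_diff D {c}) c"
proof -
  have "sym_diff (sym_diff D (V - {c})) {c} = sym_diff (sym_diff D {c}) (V - {c})"
    by auto
  then show ?thesis
    using assms
    by (simp add: star_state_def local_inversion_flip
        neighborhood_star_graph local_complement_star_graph_leaf)
qed

text \<open>
  Every vertex of \<open>D\<close> has been paid for by a block with at least one leaf press. In a star state,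
  the term \<open>1\<close> on the right is the press that will close the open block. If \<open>c \<notin> D\<close>, then the
  opening and the closing press of that block serve no vertex of \<open>D\<close>, hence the
  surplus \<open>2\<close>. A leaf press then puts \<open>c\<close> into \<open>D\<close> and spends this surplus: the two presses and the
  leaf press are the three that \<open>c\<close> costs.
\<close>

lemma string_invariant:
  assumes "finite V" "set w \<subseteq> V"
  shows "\<exists>D \<subseteq> V.
    (apply_string (complete_graph V, \<beta>) w = clique_state V \<beta> D \<and> 3 * card D \<le> length w) \<or>
    (\<exists>c \<in> V. apply_string (complete_graph V, \<beta>) w = star_state V \<beta> D c \<and>
       3 * card D + (if c \<in> D then 0 else 2) \<le> length w + 1)"
  using assms(2)
proof (induction w rule: rev_induct)
  case Nil
  have "apply_string (complete_graph V, \<beta>) [] = clique_state V \<beta> {}"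
    by (simp add: apply_string_def clique_state_def flip_def)
  then show ?case
    by (intro exI[of _ "{}"]) simp
next
  case (snoc a w)
  let ?S = "\<lambda>w. apply_string (complete_graph V, \<beta>) w"
  have step: "?S (w @ [a]) = local_inversion (?S w) a"
    by (simp add: apply_string_def)
  have a: "a \<in> V" and "set w \<subseteq> V"
    using snoc.prems by auto
  then obtain D where D: "D \<subseteq> V" and
    state: "(?S w = clique_state V \<beta> D \<and> 3 * card D \<le> length w) \<or>
      (\<exists>c \<in> V. ?S w = star_state V \<beta> D c \<and>
         3 * card D + (if c \<in> D then 0 else 2) \<le> length w + 1)"
    using snoc.IH by blast
  from state show ?case
  proof (elim disjE conjE bexE)
    assume "?S w = clique_state V \<beta> D" "3 * card D \<le> length w"
    then show ?thesis
      using D a by (intro exI[of _ D]) (auto simp: step open_block)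
  next
    fix c
    assume c: "c \<in> V" and S: "?S w = star_state V \<beta> D c"
      and len: "3 * card D + (if c \<in> D then 0 else 2) \<le> length w + 1"
    show ?thesis
    proof (cases "a = c")
      case True
      then show ?thesis
        using D c S len step
        by (intro exI[of _ D]) (auto simp: close_block split: if_splits)
    next
      case False
      let ?D = "sym_diff D {c}"
      have "finite D"
        using D assms(1) by (rule finite_subset)
      then have "3 * card ?D + (if c \<in> ?D then 0 else 2) \<le> length (w @ [a]) + 1"
        using len by (cases "c \<in> D") (auto simp: card_Diff_singleton)
      moreover have "?S (w @ [a]) = star_state V \<beta> ?D c"
        using a c False by (simp add: step S press_leaf)
      moreover have "?D \<subseteq> V"
        using D c by auto
      ultimately show ?thesis
        using c by blast
    qed
  qed
qed

lemma star_graph_neq_complete_graph: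
  assumes "3 \<le> card V"
  shows "star_graph V c \<noteq> complete_graph V"
proof
  assume "star_graph V c = complete_graph V"
  then have edges: "(\<lambda>x. {c, x}) ` (V - {c}) = nsets V 2"
    by (simp add: star_graph_def complete_graph_def)
  have "2 \<le> card (V - {c})"
    using assms by (cases "c \<in> V") (simp_all add: card_Diff_singleton_if)
  then obtain T where "T \<subseteq> V - {c}" "card T = 2"
    by (meson obtain_subset_with_card_n)
  then have "T \<in> nsets V 2" "c \<notin> T"
    by (auto simp: nsets_def intro: card_ge_0_finite)
  then show False
    using edges by blast
qed

lemma color_reversing_length_ge:
  assumes "finite V" "3 \<le> card V" "color_reversing (complete_graph V) w"
  shows "3 * card V \<le> length w"
proof -
  define \<beta> :: "'a \<Rightarrow> int" where "\<beta> = restrict (\<lambda>_. 1) V"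
  have "\<beta> \<in> bicolorings (complete_graph V)"
    by (auto simp: \<beta>_def bicolorings_def complete_graph_def)
  then have w: "set w \<subseteq> V" and
    reversed: "apply_string (complete_graph V, \<beta>) w =
      (complete_graph V, restrict (\<lambda>x. - \<beta> x) V)"
    using assms(3) by (auto simp: color_reversing_def complete_graph_def)
  have not_star: "apply_string (complete_graph V, \<beta>) w \<noteq> star_state V \<beta> D c" for D c
    using star_graph_neq_complete_graph[OF assms(2), of c]
    by (auto simp: reversed star_state_def)
  obtain D where "D \<subseteq> V" and
    D: "apply_string (complete_graph V, \<beta>) w = clique_state V \<beta> D" "3 * card D \<le> length w"
    using string_invariant[OF assms(1) w, of \<beta>] not_star by blast
  have "restrict (\<lambda>x. - \<beta> x) V = flip D \<beta>"
    using D(1) reversed by (simp add: clique_state_def)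
  then have "V \<subseteq> D"
    by (auto simp: fun_eq_iff flip_def \<beta>_def split: if_splits)
  then show ?thesis
    using D(2) \<open>D \<subseteq> V\<close> by simp
qed

lemma flip_one_vertex:
  assumes "a \<in> V" "b \<in> V" "b \<noteq> a"
  shows "apply_string (clique_state V \<beta> D) [a, b, a] = clique_state V \<beta> (sym_diff D {a})"
  using assms by (simp add: apply_string_def open_block press_leaf close_block)

lemma flip_vertices_in_turn:
  assumes "distinct xs" "set xs \<subseteq> V" "\<And>x. x \<in> V \<Longrightarrow> leaf x \<in> V \<and> leaf x \<noteq> x" "D \<inter> set xs = {}"
  shows "apply_string (clique_state V \<beta> D) (concat (map (\<lambda>x. [x, leaf x, x]) xs)) =
    clique_state V \<beta> (D \<union> set xs)"
  using assms
proof (induction xs arbitrary: D)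
  case Nil
  then show ?case
    by (simp add: apply_string_def)
next
  case (Cons a xs)
  have "apply_string (clique_state V \<beta> D) (concat (map (\<lambda>x. [x, leaf x, x]) (a # xs))) =
      apply_string (apply_string (clique_state V \<beta> D) [a, leaf a, a])
        (concat (map (\<lambda>x. [x, leaf x, x]) xs))"
    by (simp add: apply_string_def)
  also have "apply_string (clique_state V \<beta> D) [a, leaf a, a] = clique_state V \<beta> (sym_diff D {a})"
    using Cons.prems by (intro flip_one_vertex) auto
  also have "sym_diff D {a} = insert a D"
    using Cons.prems by auto
  also have "apply_string (clique_state V \<beta> (insert a D)) (concat (map (\<lambda>x. [x, leaf x, x]) xs)) =
      clique_state V \<beta> (insert a D \<union> set xs)"
    using Cons.prems by (intro Cons.IH) auto
  finally show ?case
    by simp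
qed

lemma color_reversing_string_exists:
  assumes "finite V" "2 \<le> card V"
  obtains w where "color_reversing (complete_graph V) w" "length w = 3 * card V"
proof -
  obtain xs where xs: "set xs = V" "distinct xs"
    using finite_distinct_list[OF assms(1)] by blast
  have "\<exists>y. y \<in> V \<and> y \<noteq> x" for x
  proof (rule ccontr)
    assume "\<nexists>y. y \<in> V \<and> y \<noteq> x"
    then have "card V \<le> card {x}"
      by (intro card_mono) auto
    then show False
      using assms(2) by simp
  qed
  then obtain leaf where leaf: "leaf x \<in> V \<and> leaf x \<noteq> x" for x
    by metis
  define w where "w = concat (map (\<lambda>x. [x, leaf x, x]) xs)"
  have "apply_string (complete_graph V, \<beta>) w = (complete_graph V, restrict (\<lambda>x. - \<beta> x) V)"
    if "\<beta> \<in> bicolorings (complete_graph V)" for \<beta>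
  proof -
    have "flip V \<beta> = restrict (\<lambda>x. - \<beta> x) V"
      using that by (auto simp: flip_def bicolorings_def complete_graph_def fun_eq_iff PiE_iff extensional_def)
    moreover have "clique_state V \<beta> {} = (complete_graph V, \<beta>)"
      by (simp add: clique_state_def flip_def)
    moreover have "apply_string (clique_state V \<beta> {}) w = clique_state V \<beta> V"
      using flip_vertices_in_turn[of xs V leaf "{}" \<beta>] xs leaf by (simp add: w_def)
    ultimately show ?thesis
      by (simp add: clique_state_def)
  qed
  moreover have "set w \<subseteq> V"
    using xs leaf by (auto simp: w_def)
  ultimately have "color_reversing (complete_graph V) w"
    by (simp add: color_reversing_def) (simp add: complete_graph_def)
  moreover have "length w = 3 * card V"
    using distinct_card[OF xs(2)] xs(1)
    by (simp add: w_def length_concat o_def sum_list_triv)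
  ultimately show thesis
    by (rule that)
qed

theorem theorem3:
  fixes V :: "'a set" and n :: nat
  assumes "n \<ge> 3" and "finite V" and "card V = n"
  shows "cr (complete_graph V) = enat (3 * n)"
proof (rule antisym)
  obtain w where "color_reversing (complete_graph V) w" "length w = 3 * n"
    using color_reversing_string_exists[of V] assms by auto
  then show "cr (complete_graph V) \<le> enat (3 * n)"
    unfolding cr_def by (intro INF_lower2[of w]) auto
next
  show "enat (3 * n) \<le> cr (complete_graph V)"
    unfolding cr_def using color_reversing_length_ge[of V] assms by (intro INF_greatest) auto
qed

end
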